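(* Let $c \in (1/2, 1)$, $\epsilon \in (0,1)$ and $\alpha > 0$ satisfy $c > \frac{1}{1+\epsilon^2}$ and $\alpha < \frac{(1-\epsilon)^3}{108(1+\epsilon)}$. Then for all sufficiently large $n$, no deterministic algorithm that makes at most $\alpha n$ cut queries can, for every undirected graph on vertex set $[n]$ with non-negative real edge weights, estimate the max cut value within a factor of $c$.
   Context: Cut query model: an undirected graph $G$ on vertex set $[n]$ has non-negative edge weights $w_{i,j}$, and its cut function is $F(S) = \sum_{i \in S, j \notin S} w_{i,j}$ for $S \subseteq [n]$. An algorithm has no access to $G$ except through queries: it submits a set $S \subseteq [n]$ and receives $F(S)$; queries may be chosen adaptively, computation is unlimited, and the query complexity is the number of queries. Let $\mathrm{OPT} = \max_{S \subseteq [n]} F(S)$. Estimating the max cut value within a factor of $c$ (the value estimation setting) means outputting a number $v$ with $c \cdot \mathrm{OPT} \le v \le \mathrm{OPT}$. *)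

theory Defs
  imports Complex_Main
begin

definition weighted_graph :: "nat \<Rightarrow> (nat \<Rightarrow> nat \<Rightarrow> real) \<Rightarrow> bool" where
  "weighted_graph n w \<longleftrightarrow>
     (\<forall>i\<in>{1..n}. w i i = 0 \<and> (\<forall>j\<in>{1..n}. 0 \<le> w i j \<and> w i j = w j i))"

definition cut_value :: "nat \<Rightarrow> (nat \<Rightarrow> nat \<Rightarrow> real) \<Rightarrow> nat set \<Rightarrow> real" where
  "cut_value n w S = (\<Sum>i\<in>S. \<Sum>j\<in>{1..n} - S. w i j)"

definition max_cut :: "nat \<Rightarrow> (nat \<Rightarrow> nat \<Rightarrow> real) \<Rightarrow> real" where
  "max_cut n w = Max (cut_value n w ` Pow {1..n})"

text \<open>A deterministic adaptive algorithm is a decision tree: it either halts with an output, or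
  submits a set and continues according to the real number it receives. The continuation is an
  arbitrary function of the answer, so computation is unrestricted.\<close>

datatype cut_algorithm =
    Output real
  | Query "nat set" "real \<Rightarrow> cut_algorithm"

primrec output_on :: "cut_algorithm \<Rightarrow> (nat set \<Rightarrow> real) \<Rightarrow> real" where
  "output_on (Output v) F = v"
| "output_on (Query S k) F = output_on (k (F S)) F"

primrec queries_on :: "cut_algorithm \<Rightarrow> (nat set \<Rightarrow> real) \<Rightarrow> nat set list" where
  "queries_on (Output v) F = []"
| "queries_on (Query S k) F = S # queries_on (k (F S)) F"

text \<open>Admissibility of the queries and their number are only required on answers that come from
  an actual graph; repeated queries count with multiplicity.\<close>

definition makes_at_most_cut_queries :: "nat \<Rightarrow> cut_algorithm \<Rightarrow> real \<Rightarrow> bool" where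
  "makes_at_most_cut_queries n A q \<longleftrightarrow>
     (\<forall>w. weighted_graph n w \<longrightarrow>
        set (queries_on A (cut_value n w)) \<subseteq> Pow {1..n} \<and>
        real (length (queries_on A (cut_value n w))) \<le> q)"

definition estimates_max_cut :: "nat \<Rightarrow> cut_algorithm \<Rightarrow> real \<Rightarrow> bool" where
  "estimates_max_cut n A c \<longleftrightarrow>
     (\<forall>w. weighted_graph n w \<longrightarrow>
        c * max_cut n w \<le> output_on A (cut_value n w) \<and>
        output_on A (cut_value n w) \<le> max_cut n w)"

end

theory Submission
  imports Defs
begin

text \<open>Run the algorithm on the complete graph with unit weights, whose maximum cut is at most
  $n^2/4$, and let $q$ be the number of queries. If \<open>x\<close> is a vector in $[-1,1]^n$ orthogonal to the
  constant vector and to the indicators of all queried sets, then the weights $1 - x_i x_j$ are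
  non-negative and give the same answers, since they change the cut of \<open>S\<close> by
  $x(S)\,x(V - S) = 0$. A vertex of the polytope of such \<open>x\<close> has all but $q + 1$ coordinates equal
  to $\pm 1$, and then cutting along the sign of \<open>x\<close> gives value at least $n(n - q - 1)/2$,
  almost twice the maximum cut of the complete graph when $q$ is small compared to $n$.\<close>

section \<open>Linear systems and vertices of linear sections of the cube\<close>

lemma homogeneous_system_nontrivial_solution:
  fixes fs :: "('a \<Rightarrow> real) list"
  assumes "finite V" "length fs < card V"
  shows "\<exists>y. (\<exists>i\<in>V. y i \<noteq> 0) \<and> (\<forall>f\<in>set fs. (\<Sum>i\<in>V. f i * y i) = 0)"
  using assms
proof (induction "length fs" arbitrary: fs V)
  case 0
  then have "V \<noteq> {}" by auto
  then show ?case using 0 by (intro exI[of _ "\<lambda>_. 1"]) auto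
next
  case (Suc m)
  then obtain f gs where fs: "fs = f # gs" and m: "m = length gs"
    by (metis length_Suc_conv)
  show ?case
  proof (cases "\<exists>k\<in>V. f k \<noteq> 0")
    case False
    obtain y where "\<exists>i\<in>V. y i \<noteq> 0" "\<forall>g\<in>set gs. (\<Sum>i\<in>V. g i * y i) = 0"
      using Suc.hyps(1)[OF m \<open>finite V\<close>] Suc.prems fs by auto
    then show ?thesis using False by (intro exI[of _ y]) (auto simp: fs)
  next
    case True
    then obtain k where k: "k \<in> V" "f k \<noteq> 0" by blast
    define V' where "V' = V - {k}"
    have fin: "finite V'" and kV': "k \<notin> V'" and V: "V = insert k V'"
      using Suc.prems k by (auto simp: V'_def)
    \<comment> \<open>Gaussian elimination with pivot \<open>f k\<close>: every function in
      \<open>hs\<close> vanishes at \<open>k\<close>, so a solution of the smaller system may be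
      extended to \<open>k\<close> by any value. The value chosen for \<open>z k\<close> is the one
      that solves the equation of \<open>f\<close>.\<close>
    define hs where "hs = map (\<lambda>g i. g i - g k / f k * f i) gs"
    obtain y where y: "\<exists>i\<in>V'. y i \<noteq> 0" "\<forall>h\<in>set hs. (\<Sum>i\<in>V'. h i * y i) = 0"
      using Suc.hyps(1)[of hs V'] Suc.prems fin kV' m by (auto simp: V fs hs_def)
    define s where "s = (\<Sum>i\<in>V'. f i * y i)"
    define z where "z = y(k := - s / f k)"
    have z: "(\<Sum>i\<in>V. g i * z i) = g k * (- s / f k) + (\<Sum>i\<in>V'. g i * y i)" for g
    proof -
      have "(\<Sum>i\<in>V'. g i * z i) = (\<Sum>i\<in>V'. g i * y i)"
        using kV' by (intro sum.cong) (auto simp: z_def)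
      then show ?thesis using fin kV' by (simp add: V z_def)
    qed
    have "(\<Sum>i\<in>V. g i * z i) = 0" if "g \<in> set gs" for g
    proof -
      have "0 = (\<Sum>i\<in>V'. (g i - g k / f k * f i) * y i)"
        using y(2) that by (auto simp: hs_def)
      also have "\<dots> = (\<Sum>i\<in>V'. g i * y i) - g k / f k * s"
        by (simp add: left_diff_distrib sum_subtractf s_def sum_distrib_left mult.assoc)
      finally show ?thesis by (simp add: z)
    qed
    moreover have "(\<Sum>i\<in>V. f i * z i) = 0" using k by (simp add: z s_def)
    moreover have "\<exists>i\<in>V. z i \<noteq> 0" using y(1) kV' by (auto simp: z_def V)
    ultimately show ?thesis by (intro exI[of _ z]) (auto simp: fs)
  qed
qed

text \<open>Start at an interior point of the cube and walk in direction \<open>y\<close> until the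
  first coordinate reaches the boundary.\<close>

lemma move_to_cube_boundary:
  fixes x y :: "'a \<Rightarrow> real"
  assumes "finite V" "\<And>i. i \<in> V \<Longrightarrow> \<bar>x i\<bar> < 1" "\<exists>i\<in>V. y i \<noteq> 0"
  shows "\<exists>t. (\<forall>i\<in>V. \<bar>x i + t * y i\<bar> \<le> 1) \<and> (\<exists>i\<in>V. \<bar>x i + t * y i\<bar> = 1)"
proof -
  define W where "W = {i\<in>V. y i \<noteq> 0}"
  \<comment> \<open>\<open>r i\<close> is the time at which coordinate \<open>i\<close> reaches the
    face that it moves towards, at \<open>sgn (y i)\<close>. The minimum \<open>t\<close> of these
    times is the first hit.\<close>
  define r where "r = (\<lambda>i. (1 - sgn (y i) * x i) / \<bar>y i\<bar>)"
  define t where "t = Min (r ` W)"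
  have W: "finite (r ` W)" "r ` W \<noteq> {}" using assms by (auto simp: W_def)
  have t_le: "t \<le> r i" if "i \<in> W" for i using W that by (simp add: t_def)
  have "t \<in> r ` W" using W unfolding t_def by (rule Min_in)
  then obtain k where k: "k \<in> W" "t = r k" by blast
  have "0 \<le> r k"
    using assms(2)[of k] k(1) by (auto simp: r_def W_def sgn_if)
  then have "0 \<le> t" using k by simp
  have "\<bar>x i + t * y i\<bar> \<le> 1" if i: "i \<in> V" for i
  proof (cases "y i = 0")
    case True
    then show ?thesis using assms(2)[OF i] by simp
  next
    case False
    then have "t * \<bar>y i\<bar> \<le> 1 - sgn (y i) * x i"
      using t_le[of i] i by (simp add: W_def r_def field_simps)
    moreover have "0 \<le> t * \<bar>y i\<bar>" using \<open>0 \<le> t\<close> by simp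
    ultimately show ?thesis
      using False assms(2)[OF i] by (cases "y i > 0") (auto simp: abs_if)
  qed
  moreover have "\<bar>x k + t * y k\<bar> = 1"
    using k by (cases "y k > 0") (auto simp: W_def r_def field_simps)
  ultimately show ?thesis using k(1) by (auto simp: W_def)
qed

text \<open>While there are more free coordinates than constraints, some nonzero direction supported
  on the free ones preserves all constraints. Moving along it to the boundary fixes at least one
  more coordinate and leaves those already at 1 or -1 alone, so the number of free coordinates
  drops.\<close>

lemma cube_section_vertex:
  fixes fs :: "('a \<Rightarrow> real) list"
  assumes "finite V"
  shows "\<exists>x. (\<forall>i\<in>V. \<bar>x i\<bar> \<le> 1) \<and> (\<forall>f\<in>set fs. (\<Sum>i\<in>V. f i * x i) = 0)
    \<and> card {i\<in>V. \<bar>x i\<bar> \<noteq> 1} \<le> length fs"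
proof -
  define feas where "feas = (\<lambda>x. (\<forall>i\<in>V. \<bar>x i\<bar> \<le> 1) \<and> (\<forall>f\<in>set fs. (\<Sum>i\<in>V. f i * x i) = 0))"
  define free where "free = (\<lambda>x::'a \<Rightarrow> real. {i\<in>V. \<bar>x i\<bar> \<noteq> 1})"
  have "\<exists>x'. feas x' \<and> card (free x') \<le> length fs" if "feas x" for x
    using that
  proof (induction "card (free x)" arbitrary: x rule: less_induct)
    case less
    show ?case
    proof (cases "card (free x) \<le> length fs")
      case False
      have fin: "finite (free x)" using assms by (simp add: free_def)
      obtain y where y: "\<exists>i\<in>free x. y i \<noteq> 0" "\<forall>f\<in>set fs. (\<Sum>i\<in>free x. f i * y i) = 0"
        using homogeneous_system_nontrivial_solution[OF fin, of fs] False by auto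
      have "\<bar>x i\<bar> < 1" if "i \<in> free x" for i
        using less.prems that by (force simp: feas_def free_def)
      then obtain t k where t: "\<forall>i\<in>free x. \<bar>x i + t * y i\<bar> \<le> 1"
        and k: "k \<in> free x" "\<bar>x k + t * y k\<bar> = 1"
        using move_to_cube_boundary[OF fin _ y(1), of x] by blast
      define x' where "x' = (\<lambda>i. if i \<in> free x then x i + t * y i else x i)"
      have "(\<Sum>i\<in>V. f i * x' i) = 0" if f: "f \<in> set fs" for f
      proof -
        have "(\<Sum>i\<in>V. f i * x' i)
            = (\<Sum>i\<in>V. f i * x i) + (\<Sum>i\<in>V. if i \<in> free x then t * (f i * y i) else 0)"
          unfolding sum.distrib[symmetric] by (intro sum.cong) (auto simp: x'_def algebra_simps)
        also have "(\<Sum>i\<in>V. if i \<in> free x then t * (f i * y i) else 0)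
            = (\<Sum>i\<in>free x. t * (f i * y i))"
          using assms by (intro sum.mono_neutral_cong_right) (auto simp: free_def)
        also have "\<dots> = 0" using y(2) f by (simp flip: sum_distrib_left)
        finally show ?thesis using less.prems f by (simp add: feas_def)
      qed
      then have "feas x'" using less.prems t by (auto simp: feas_def x'_def)
      moreover have "free x' \<subset> free x"
        using k by (auto simp: free_def x'_def)
      ultimately show ?thesis using less.hyps[of x'] fin by (simp add: psubset_card_mono)
    qed (use less.prems in blast)
  qed
  moreover have "feas (\<lambda>_. 0)" by (simp add: feas_def)
  ultimately obtain x where "feas x" "card (free x) \<le> length fs" by blast
  then show ?thesis by (auto simp: feas_def free_def)
qed

section \<open>Runs on equal answers, and cuts of perturbed complete graphs\<close>

lemma run_cong:
  assumes "\<And>S. S \<in> set (queries_on A F) \<Longrightarrow> F S = G S"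
  shows "output_on A F = output_on A G"
  \<comment> \<open>Agreement on the sets queried in the run on \<open>F\<close> suffices: at every
    node the answers coincide, so the run on \<open>G\<close> descends along the same path.\<close>
  using assms by (induction A) auto

definition perturbed_complete_graph :: "(nat \<Rightarrow> real) \<Rightarrow> nat \<Rightarrow> nat \<Rightarrow> real" where
  "perturbed_complete_graph x i j = (if i = j then 0 else 1 - x i * x j)"

lemma weighted_graph_perturbed_complete_graph:
  assumes "\<And>i. i \<in> {1..n} \<Longrightarrow> \<bar>x i\<bar> \<le> 1"
  shows "weighted_graph n (perturbed_complete_graph x)"
proof -
  have "x i * x j \<le> 1" if "i \<in> {1..n}" "j \<in> {1..n}" for i j
  proof -
    have "\<bar>x i\<bar> * \<bar>x j\<bar> \<le> 1" using assms that by (simp add: mult_le_one)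
    then show ?thesis by (simp add: abs_le_iff flip: abs_mult)
  qed
  then show ?thesis by (auto simp: weighted_graph_def perturbed_complete_graph_def mult.commute)
qed

lemma cut_value_perturbed_complete_graph:
  "cut_value n (perturbed_complete_graph x) S
    = real (card S) * real (card ({1..n} - S)) - sum x S * sum x ({1..n} - S)"
proof -
  have "cut_value n (perturbed_complete_graph x) S = (\<Sum>i\<in>S. \<Sum>j\<in>{1..n} - S. 1 - x i * x j)"
    unfolding cut_value_def
    by (intro sum.cong) (auto simp: perturbed_complete_graph_def)
  then show ?thesis by (simp add: sum_subtractf sum_product)
qed

lemma cut_le_max_cut: "S \<subseteq> {1..n} \<Longrightarrow> cut_value n w S \<le> max_cut n w"
  by (simp add: max_cut_def)

lemma max_cut_complete_graph_le:
  "max_cut n (perturbed_complete_graph (\<lambda>_. 0)) \<le> (real n)\<^sup>2 / 4"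
  unfolding max_cut_def
proof (rule Max.boundedI)
  fix a assume "a \<in> cut_value n (perturbed_complete_graph (\<lambda>_. 0)) ` Pow {1..n}"
  then obtain S where S: "S \<subseteq> {1..n}"
    and a: "a = real (card S) * real (card ({1..n} - S))"
    by (auto simp: cut_value_perturbed_complete_graph)
  have compl: "real (card ({1..n} - S)) = real n - real (card S)"
    using S card_mono[OF _ S] by (simp add: card_Diff_subset finite_subset of_nat_diff)
  have "0 \<le> (real n - 2 * real (card S))\<^sup>2" by simp
  then show "a \<le> (real n)\<^sup>2 / 4"
    unfolding a compl by (simp add: power2_eq_square algebra_simps)
qed auto

text \<open>Since \<open>x\<close> sums to 0, its positive part has sum \<open>p\<close> and the
  rest has sum \<open>- p\<close>, so the cut along the sign has value
  \<open>card S * card T + p^2\<close>. Put \<open>a = (n - d) / 2\<close>. Then \<open>p\<close>,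
  \<open>card S\<close> and \<open>card T\<close> are all at least \<open>a\<close>, and the two
  terms together give at least \<open>a * n\<close>.\<close>

lemma max_cut_perturbed_complete_graph_ge:
  assumes x: "\<And>i. i \<in> {1..n} \<Longrightarrow> \<bar>x i\<bar> \<le> 1" and "sum x {1..n} = 0"
    and d: "real (card {i\<in>{1..n}. \<bar>x i\<bar> \<noteq> 1}) \<le> d" "d \<le> n"
  shows "real n * (real n - d) / 2 \<le> max_cut n (perturbed_complete_graph x)"
proof -
  define S where "S = {i\<in>{1..n}. 0 < x i}"
  define T where "T = {1..n} - S"
  define p where "p = sum x S"
  have S: "S \<subseteq> {1..n}" and fin: "finite S" "finite T" by (auto simp: S_def T_def)
  have split: "sum g {1..n} = sum g S + sum g T" for g :: "nat \<Rightarrow> real"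
    unfolding T_def using S by (simp add: sum.subset_diff)
  have T: "sum x T = - p" using split[of x] assms(2) by (simp add: p_def)
  have cards: "real (card S) + real (card T) = real n" using split[of "\<lambda>_. 1"] by simp
  have "sum x S \<le> (\<Sum>i\<in>S. 1)"
    using x S by (intro sum_mono) force
  then have pS: "p \<le> card S" by (simp add: p_def)
  have "(\<Sum>i\<in>T. - x i) \<le> (\<Sum>i\<in>T. 1)"
    using x by (intro sum_mono) (force simp: T_def)
  then have pT: "p \<le> card T" by (simp add: T sum_negf)
  have "sum (\<lambda>i. \<bar>x i\<bar>) S = p" unfolding p_def by (intro sum.cong) (auto simp: S_def)
  moreover have "sum (\<lambda>i. \<bar>x i\<bar>) T = (\<Sum>i\<in>T. - x i)"
    by (intro sum.cong) (auto simp: S_def T_def)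
  ultimately have norm: "(\<Sum>i=1..n. \<bar>x i\<bar>) = 2 * p"
    using split[of "\<lambda>i. \<bar>x i\<bar>"] by (simp add: T sum_negf)
  let ?B = "{i\<in>{1..n}. \<bar>x i\<bar> \<noteq> 1}"
  \<comment> \<open>Each coordinate outside \<open>?B\<close> contributes 1 to the sum of absolute
    values, which is \<open>2 * p\<close>.\<close>
  have "real n - real (card ?B) = (\<Sum>i=1..n. 1 - (if \<bar>x i\<bar> \<noteq> 1 then 1 else 0))"
    by (simp add: sum_subtractf sum.If_cases Int_def)
  also have "\<dots> \<le> (\<Sum>i=1..n. \<bar>x i\<bar>)" by (intro sum_mono) auto
  finally have p: "real n - d \<le> 2 * p" using d norm by simp
  \<comment> \<open>With \<open>card S + card T = n\<close>, expanding this product of non-negative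
    factors bounds \<open>card S * card T\<close> below by \<open>a * n - a^2\<close>. The missing
    \<open>a^2\<close> is supplied by \<open>p^2\<close>.\<close>
  have "0 \<le> (real (card S) - (real n - d) / 2) * (real (card T) - (real n - d) / 2)"
    using p pS pT by simp
  also have "\<dots> = real (card S) * real (card T)
      - (real n - d) / 2 * (real (card S) + real (card T)) + ((real n - d) / 2)\<^sup>2"
    by (simp add: power2_eq_square field_simps)
  finally have "(real n - d) / 2 * real n - ((real n - d) / 2)\<^sup>2 \<le> real (card S) * real (card T)"
    by (simp add: cards)
  moreover have "((real n - d) / 2)\<^sup>2 \<le> p\<^sup>2"
    using p d by (intro power_mono) auto
  ultimately have "real n * (real n - d) / 2 \<le> real (card S) * real (card T) + p\<^sup>2"
    by (simp add: mult.commute)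
  also have "\<dots> = cut_value n (perturbed_complete_graph x) S"
    unfolding cut_value_perturbed_complete_graph T_def[symmetric] T
    by (simp add: p_def power2_eq_square)
  also have "\<dots> \<le> max_cut n (perturbed_complete_graph x)" using S by (rule cut_le_max_cut)
  finally show ?thesis .
qed

section \<open>The lower bound on the number of queries\<close>

lemma estimation_query_lower_bound:
  assumes "makes_at_most_cut_queries n A q" "estimates_max_cut n A c" "0 < n" "0 < c"
  shows "2 * c * (real n - q - 1) \<le> real n"
proof (cases "q + 1 \<le> real n")
  \<comment> \<open>Here \<open>n - q - 1\<close> is negative, so the left side is at most
    0.\<close>
  case False
  then have "c * (real n - q - 1) \<le> 0"
    using \<open>0 < c\<close> by (simp add: mult_le_0_iff)
  then show ?thesis by (simp add: mult.assoc)
next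
  case True
  define w0 where "w0 = perturbed_complete_graph (\<lambda>_. 0)"
  define qs where "qs = queries_on A (cut_value n w0)"
  have w0: "weighted_graph n w0"
    unfolding w0_def by (rule weighted_graph_perturbed_complete_graph) simp
  have qs: "set qs \<subseteq> Pow {1..n}" "real (length qs) \<le> q"
    using assms(1) w0 by (auto simp: makes_at_most_cut_queries_def qs_def)
  \<comment> \<open>The indicators of the queried sets make the two graphs indistinguishable. That
    of \<open>{1..n}\<close> forces \<open>x\<close> to sum to 0, as the lower bound on the max cut
    requires, and accounts for the \<open>+ 1\<close> in \<open>q + 1\<close>.\<close>
  define fs where "fs = map (\<lambda>S i. of_bool (i \<in> S) :: real) ({1..n} # qs)"
  obtain x where x: "\<forall>i\<in>{1..n}. \<bar>x i\<bar> \<le> 1" "\<forall>f\<in>set fs. (\<Sum>i=1..n. f i * x i) = 0"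
    "card {i\<in>{1..n}. \<bar>x i\<bar> \<noteq> 1} \<le> length fs"
    using cube_section_vertex[of "{1..n}" fs] by blast
  have sum0: "sum x S = 0" if "S \<in> insert {1..n} (set qs)" for S
  proof -
    have S: "S \<subseteq> {1..n}" using that qs by auto
    have "0 = (\<Sum>i=1..n. of_bool (i \<in> S) * x i)" using x(2) that by (auto simp: fs_def)
    also have "\<dots> = sum x S"
      using S by (intro sum.mono_neutral_cong_right) auto
    finally show ?thesis by simp
  qed
  define w where "w = perturbed_complete_graph x"
  have w: "weighted_graph n w"
    unfolding w_def using x(1) by (intro weighted_graph_perturbed_complete_graph) auto
  have "cut_value n w0 S = cut_value n w S" if "S \<in> set qs" for S
    using sum0[of S] that by (simp add: w_def w0_def cut_value_perturbed_complete_graph)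
  then have same: "output_on A (cut_value n w0) = output_on A (cut_value n w)"
    unfolding qs_def by (rule run_cong)
  have "real n * (real n - (q + 1)) / 2 \<le> max_cut n w"
    unfolding w_def
    using x sum0[of "{1..n}"] qs True
    by (intro max_cut_perturbed_complete_graph_ge) (auto simp: fs_def)
  then have "c * (real n * (real n - (q + 1)) / 2) \<le> c * max_cut n w"
    using \<open>0 < c\<close> by simp
  also have "\<dots> \<le> output_on A (cut_value n w)"
    using assms(2) w by (simp add: estimates_max_cut_def)
  \<comment> \<open>The common output must be valid for both graphs: at least \<open>c\<close> times
    the max cut of \<open>w\<close>, yet at most that of \<open>w0\<close>.\<close>
  also have "\<dots> \<le> max_cut n w0"
    using assms(2) w0 by (simp add: estimates_max_cut_def flip: same)
  also have "\<dots> \<le> (real n)\<^sup>2 / 4"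
    unfolding w0_def by (rule max_cut_complete_graph_le)
  finally have "real n * (2 * c * (real n - q - 1)) \<le> real n * real n"
    by (simp add: power2_eq_square algebra_simps)
  then show ?thesis using \<open>0 < n\<close> by simp
qed

theorem theorem3p1:
  fixes c \<epsilon> \<alpha> :: real
  assumes "1 / 2 < c" and "c < 1"
    and "0 < \<epsilon>" and "\<epsilon> < 1"
    and "0 < \<alpha>"
    and "c > 1 / (1 + \<epsilon>\<^sup>2)"
    and "\<alpha> < (1 - \<epsilon>) ^ 3 / (108 * (1 + \<epsilon>))"
  shows "\<exists>N::nat. \<forall>n\<ge>N. \<not> (\<exists>A.
           makes_at_most_cut_queries n A (\<alpha> * real n) \<and> estimates_max_cut n A c)"
proof -
  \<comment> \<open>The bound on \<alpha> yields 2 \<alpha> < 1 - \<epsilon> \<le> (1 - \<epsilon>)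
    (1 + \<epsilon>), so the coefficient in \<open>gap\<close> is positive.\<close>
  have "(1 - \<epsilon>) ^ 3 / (108 * (1 + \<epsilon>)) \<le> (1 - \<epsilon>) ^ 1 / 2"
    using assms by (intro frac_le power_decreasing) auto
  moreover have "(1 - \<epsilon>) * 1 \<le> (1 - \<epsilon>) * (1 + \<epsilon>)"
    using assms by (intro mult_left_mono) auto
  ultimately have gap: "0 < 1 - \<epsilon>\<^sup>2 - 2 * \<alpha>"
    using assms(7) by (simp add: power2_eq_square algebra_simps)
  have c: "1 \<le> c * (1 + \<epsilon>\<^sup>2)"
    using assms(6) by (simp add: pos_divide_less_eq add_pos_nonneg)
  \<comment> \<open>The query bound and the hypothesis on \<open>c\<close> will give \<open>2 * (n -
    \<alpha> * n - 1) \<le> (1 + \<epsilon>\<^sup>2) * n\<close>, that is,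
    \<open>(1 - \<epsilon>\<^sup>2 - 2 * \<alpha>) * n \<le> 2\<close>. This \<open>N\<close> is
    large enough to contradict it.\<close>
  obtain N :: nat where N: "2 / (1 - \<epsilon>\<^sup>2 - 2 * \<alpha>) < N"
    using reals_Archimedean2 by blast
  have False if n: "n \<ge> N" and A: "makes_at_most_cut_queries n A (\<alpha> * real n)"
    "estimates_max_cut n A c" for n A
  proof -
    have "2 / (1 - \<epsilon>\<^sup>2 - 2 * \<alpha>) < real n" using N n by simp
    then have large: "2 < (1 - \<epsilon>\<^sup>2 - 2 * \<alpha>) * real n"
      using gap by (simp add: pos_divide_less_eq mult.commute)
    then have "0 < n" by (cases n) auto
    have "c * (2 * (real n - \<alpha> * real n - 1)) \<le> real n"
      using estimation_query_lower_bound[OF A \<open>0 < n\<close>] assms(1) by (simp add: mult_ac)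
    also have "\<dots> \<le> c * (1 + \<epsilon>\<^sup>2) * real n"
      using mult_right_mono[OF c, of "real n"] by simp
    finally have "2 * (real n - \<alpha> * real n - 1) \<le> (1 + \<epsilon>\<^sup>2) * real n"
      using assms(1) by (simp add: mult.assoc)
    then show False using large by (simp add: algebra_simps)
  qed
  then show ?thesis by blast
qed

end
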